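(* Let $c_1,c_2>0$ and $0<z_1<1<z_2$ satisfy $\frac{c_1^2}{c_2}\ge(\sqrt{z_1}+\sqrt{z_2})^2$. Then for any $(u,(x,y))\in(0,\infty)\times\mathcal E_-$, $$\pi(u,\sigma(x,y))=s(\pi(u,(x,y))).$$
   Context: $\mathcal S$ is the set of matrix functions $\begin{pmatrix}a_{11}&a_{12}+b_{12}z\\ a_{21}+b_{21}/z&a_{22}\end{pmatrix}$ with $a_{11},a_{22},a_{12},a_{21},b_{12},b_{21}>0$, and $\mathcal S(z_1,z_2,c_1,c_2)=\{P\in\mathcal S:\ \mathrm{Tr}\,P(z)=2c_1,\ \det P(z)=-c_2(z-z_1)(z-z_2)/z\}$. Elliptic curve: $\mathcal E=\{(x,y)\in\mathbb R^2: c_1^2(y^2-x^2)=c_2x(x-z_1)(x-z_2)\}$, $\mathcal E_-=\{(x,y)\in\mathcal E:x<0\}$. The map $\sigma:\mathcal E_-\to\mathcal E_-$ is $\sigma(x,y)=(x,y)+(z_2,z_2)$ for the group law on $\mathcal E$ with the point at infinity as identity: $\sigma(x,y)$ is the reflection in the $x$-axis of the third intersection point (counted with multiplicity) with $\mathcal E$ of the line through $(x,y)$ and $(z_2,z_2)$. Map $\pi:(0,\infty)\times\mathcal E_-\to\mathcal S(z_1,z_2,c_1,c_2)$: $$\pi(u,(x,y))=\begin{pmatrix}c_1(1-\frac yx)&u(z-x)\\ \frac{c_2}u\left(1-\frac{z_1z_2}{xz}\right)&c_1(1+\frac yx)\end{pmatrix}.$$ Map $s:\mathcal S(z_1,z_2,c_1,c_2)\to\mathcal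 S(z_1,z_2,c_1,c_2)$: every $P\in\mathcal S(z_1,z_2,c_1,c_2)$ has a unique factorization $P=Q_-Q_+$ with $Q_-=\begin{pmatrix}a&0\\0&1\end{pmatrix}\begin{pmatrix}1&1\\ \frac{\zeta_1}z&1\end{pmatrix}\begin{pmatrix}b&0\\0&1\end{pmatrix}$, $Q_+=\begin{pmatrix}1&0\\0&c\end{pmatrix}\begin{pmatrix}1&\frac z{\zeta_2}\\1&1\end{pmatrix}\begin{pmatrix}1&0\\0&d\end{pmatrix}$, where $a,b,c,d>0$, $0<\zeta_1<1<\zeta_2$. With $D=\begin{pmatrix}1&0\\0&ab\end{pmatrix}$, $P_+=D^{-1}Q_+$ and $P_-=Q_-D$, set $s(P)=P_+P_-$. *)

theory Defs
  imports "HOL-Analysis.Analysis" "HOL-Computational_Algebra.Computational_Algebra"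
begin

definition mat2 :: "'a::zero \<Rightarrow> 'a \<Rightarrow> 'a \<Rightarrow> 'a \<Rightarrow> 'a^2^2" where
  "mat2 a b c d = vector [vector [a, b], vector [c, d]]"

text \<open>
  A matrix function lives on the punctured plane. It is represented by a function that takes the
  dummy value \<^term>\<open>undefined\<close> at 0, so that equality of terms is equality of functions of
  a nonzero complex variable.
\<close>

type_synonym matfun = "complex \<Rightarrow> complex^2^2"

definition symbols :: "matfun set" where
  "symbols =
    {(\<lambda>z\<in>-{0}. mat2 (of_real a11) (of_real a12 + of_real b12 * z)
                   (of_real a21 + of_real b21 / z) (of_real a22))
      | a11 a12 a21 a22 b12 b21 :: real.
      a11 > 0 \<and> a22 > 0 \<and> a12 > 0 \<and> a21 > 0 \<and> b12 > 0 \<and> b21 > 0}"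

definition symbols_fix :: "real \<Rightarrow> real \<Rightarrow> real \<Rightarrow> real \<Rightarrow> matfun set" where
  "symbols_fix z1 z2 c1 c2 =
    {P \<in> symbols. \<forall>z. z \<noteq> 0 \<longrightarrow>
       trace (P z) = 2 * of_real c1 \<and>
       det (P z) = - of_real c2 * (z - of_real z1) * (z - of_real z2) / z}"

definition ell_curve :: "real \<Rightarrow> real \<Rightarrow> real \<Rightarrow> real \<Rightarrow> (real \<times> real) set" where
  "ell_curve z1 z2 c1 c2 = {(x, y). c1^2 * (y^2 - x^2) = c2 * x * (x - z1) * (x - z2)}"

definition ell_curve_minus :: "real \<Rightarrow> real \<Rightarrow> real \<Rightarrow> real \<Rightarrow> (real \<times> real) set" where
  "ell_curve_minus z1 z2 c1 c2 = {(x, y) \<in> ell_curve z1 z2 c1 c2. x < 0}"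

text \<open>
  The equation of the curve pulled back along the affine parametrisation
  \<open>t \<mapsto> p + t (q - p)\<close> of the line through \<open>p\<close> and \<open>q\<close>. Its roots, with
  multiplicities, are the affine intersection points of the line with the curve.
\<close>

definition line_restriction ::
  "real \<Rightarrow> real \<Rightarrow> real \<Rightarrow> real \<Rightarrow> real \<times> real \<Rightarrow> real \<times> real \<Rightarrow> real poly" where
  "line_restriction z1 z2 c1 c2 p q =
    (let X = [:fst p, fst q - fst p:]; Y = [:snd p, snd q - snd p:]
     in smult (c1^2) (Y^2 - X^2) - smult c2 (X * (X - [:z1:]) * (X - [:z2:])))"

text \<open>
  The parameters 0 and 1 belong to \<open>p\<close> and \<open>q\<close>; \<open>t = 0\<close> and \<open>t = 1\<close> are the tangent cases.
\<close>

definition third_intersection ::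
  "real \<Rightarrow> real \<Rightarrow> real \<Rightarrow> real \<Rightarrow> real \<times> real \<Rightarrow> real \<times> real \<Rightarrow> real \<times> real \<Rightarrow> bool" where
  "third_intersection z1 z2 c1 c2 p q r \<longleftrightarrow>
    p \<noteq> q \<and>
    (\<exists>t. proots (line_restriction z1 z2 c1 c2 p q) = {#0, 1, t#} \<and> r = p + t *\<^sub>R (q - p))"

definition ell_shift :: "real \<Rightarrow> real \<Rightarrow> real \<Rightarrow> real \<Rightarrow> real \<times> real \<Rightarrow> real \<times> real" where
  "ell_shift z1 z2 c1 c2 p =
    (let r = (THE r. third_intersection z1 z2 c1 c2 p (z2, z2) r) in (fst r, - snd r))"

definition param_map ::
  "real \<Rightarrow> real \<Rightarrow> real \<Rightarrow> real \<Rightarrow> real \<times> (real \<times> real) \<Rightarrow> matfun" where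
  "param_map z1 z2 c1 c2 = (\<lambda>(u, (x, y)). \<lambda>z\<in>-{0}.
     mat2 (of_real (c1 * (1 - y / x)))
          (of_real u * (z - of_real x))
          (of_real (c2 / u) * (1 - of_real (z1 * z2) / (of_real x * z)))
          (of_real (c1 * (1 + y / x))))"

definition Q_minus :: "real \<Rightarrow> real \<Rightarrow> real \<Rightarrow> matfun" where
  "Q_minus a b \<zeta>1 z =
    mat2 (of_real a) 0 0 1 ** mat2 1 1 (of_real \<zeta>1 / z) 1 ** mat2 (of_real b) 0 0 1"

definition Q_plus :: "real \<Rightarrow> real \<Rightarrow> real \<Rightarrow> matfun" where
  "Q_plus c d \<zeta>2 z =
    mat2 1 0 0 (of_real c) ** mat2 1 (z / of_real \<zeta>2) 1 1 ** mat2 1 0 0 (of_real d)"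

definition factor_data ::
  "matfun \<Rightarrow> real \<times> real \<times> real \<times> real \<times> real \<times> real \<Rightarrow> bool" where
  "factor_data P = (\<lambda>(a, b, c, d, \<zeta>1, \<zeta>2).
     a > 0 \<and> b > 0 \<and> c > 0 \<and> d > 0 \<and> 0 < \<zeta>1 \<and> \<zeta>1 < 1 \<and> 1 < \<zeta>2 \<and>
     (\<forall>z. z \<noteq> 0 \<longrightarrow> P z = Q_minus a b \<zeta>1 z ** Q_plus c d \<zeta>2 z))"

definition switch_map :: "real \<Rightarrow> real \<Rightarrow> real \<Rightarrow> real \<Rightarrow> matfun \<Rightarrow> matfun" where
  "switch_map z1 z2 c1 c2 = (\<lambda>P \<in> symbols_fix z1 z2 c1 c2.
     (case (THE w. factor_data P w) of (a, b, c, d, \<zeta>1, \<zeta>2) \<Rightarrow>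
        let D = mat2 1 0 0 (of_real (a * b));
            P_plus = (\<lambda>z. matrix_inv D ** Q_plus c d \<zeta>2 z);
            P_minus = (\<lambda>z. Q_minus a b \<zeta>1 z ** D)
        in (\<lambda>z\<in>-{0}. P_plus z ** P_minus z)))"

end

theory Submission
  imports Defs
begin

text \<open>
  Let \<open>n = (x - y) / (x - z2)\<close>, which is one minus the slope of the chord from \<open>(x, y)\<close> to
  \<open>(z2, z2)\<close>, so that \<open>y = x - n (x - z2)\<close>. On this line \<open>Y - X = n (z2 - X)\<close>, hence the factor
  \<open>X - z2\<close> splits off from the equation of the curve, and at the point \<open>(x, y)\<close> itself the
  equation becomes the chord relation \<open>c1^2 n (x + y) = -c2 x (x - z1)\<close>. Both sides of the theorem
  are rational functions of \<open>x\<close> and \<open>n\<close>, and both are simple.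

  Geometric side: by Vieta for the restriction of the curve to the chord, the product of the
  abscissae \<open>x\<close>, \<open>z2\<close> and \<open>X\<close> of the three intersection points is \<open>c1^2 (z2 n)^2 / c2\<close>, since
  \<open>z2 n\<close> is the ordinate of the line above 0. This gives \<open>X = c1^2 z2 n^2 / (c2 x)\<close>
  (lemmas \<open>line_restriction_factored\<close> and \<open>ell_shift_eq\<close>).

  Matrix side: comparing the six coefficients of \<open>P = Q_- Q_+\<close> gives
  \<open>a = c1 u n / c2\<close>, \<open>b = -c2 z2 / (u x)\<close>, \<open>c = c2 / u\<close>, \<open>d = -u x / (c1 n)\<close>. The zeros
  \<open>\<zeta>1, \<zeta>2\<close> of the determinant are determined by their sum, their product and the condition
  \<open>\<zeta>1 < 1 < \<zeta>2\<close>, hence equal to \<open>z1, z2\<close> (lemma \<open>factor_data_param_map_iff\<close>).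
  On the negative part of the curve \<open>\<bar>y\<bar> < -x\<close>, so \<open>n > 0\<close> and these parameters are positive.

  The entry of the switched product that has its zero at the new abscissa is a multiple of
  \<open>a + d z / z2\<close>, so the new abscissa is \<open>-a z2 / d\<close>, and this is the \<open>X\<close> above. The diagonal
  of the switched product then yields minus the ordinate of the third intersection point.
\<close>

section \<open>Two by two matrix functions with real coefficients\<close>

lemma mat2_mult:
  fixes a b c d a' b' c' d' :: complex
  shows "mat2 a b c d ** mat2 a' b' c' d' =
    mat2 (a * a' + b * c') (a * b' + b * d') (c * a' + d * c') (c * b' + d * d')"
  by (simp add: mat2_def matrix_matrix_mult_def vec_eq_iff forall_2 sum_2)

lemma mat2_eq_iff:
  "mat2 a b c d = mat2 a' b' c' d' \<longleftrightarrow> a = a' \<and> b = b' \<and> c = c' \<and> d = d'"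
  by (auto simp: mat2_def vec_eq_iff forall_2)

lemma trace_mat2: "trace (mat2 a b c d) = a + d"
  by (simp add: mat2_def trace_def sum_2)

lemma det_mat2: "det (mat2 a b c d) = a * d - b * c"
  by (simp add: mat2_def det_2)

lemma matrix_inv_unique:
  fixes A :: "'a::semiring_1^'n^'m"
  assumes "A ** B = mat 1" "B ** A = mat 1"
  shows "matrix_inv A = B"
proof -
  have "matrix_inv A ** A = mat 1"
    using someI[of "\<lambda>C. A ** C = mat 1 \<and> C ** A = mat 1" B] assms
    by (simp add: matrix_inv_def)
  then have "matrix_inv A ** A ** B = B"
    by simp
  then show ?thesis
    using assms by (simp add: matrix_mul_assoc[symmetric])
qed

lemma matrix_inv_mat2_diag:
  fixes e :: complex
  assumes "e \<noteq> 0"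
  shows "matrix_inv (mat2 1 0 0 e) = mat2 1 0 0 (1 / e)"
proof -
  have "mat 1 = (mat2 1 0 0 1 :: complex^2^2)"
    by (simp add: mat2_def mat_def vec_eq_iff forall_2)
  then show ?thesis
    using assms by (intro matrix_inv_unique) (simp_all add: mat2_mult)
qed

definition symbol :: "real \<Rightarrow> real \<Rightarrow> real \<Rightarrow> real \<Rightarrow> real \<Rightarrow> real \<Rightarrow> matfun" where
  "symbol a11 a12 b12 a21 b21 a22 z =
    mat2 (of_real a11) (of_real a12 + of_real b12 * z)
         (of_real a21 + of_real b21 / z) (of_real a22)"

lemma symbol_eq_iff:
  "(\<forall>z. z \<noteq> 0 \<longrightarrow> symbol a11 a12 b12 a21 b21 a22 z = symbol a11' a12' b12' a21' b21' a22' z) \<longleftrightarrow>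
    a11 = a11' \<and> a12 = a12' \<and> b12 = b12' \<and> a21 = a21' \<and> b21 = b21' \<and> a22 = a22'"
    (is "?eq \<longleftrightarrow> ?coeffs")
proof
  assume ?eq
  \<comment> \<open>Two sample points determine each affine function of \<open>z\<close> and of \<open>1 / z\<close>.\<close>
  from this[rule_format, of 1] this[rule_format, of "-1"]
  have "a11 = a11'" "a22 = a22'" "a12 + b12 = a12' + b12'" "a12 - b12 = a12' - b12'"
    "a21 + b21 = a21' + b21'" "a21 - b21 = a21' - b21'"
    by (simp_all add: symbol_def mat2_eq_iff flip: of_real_add of_real_diff)
  then show ?coeffs
    by linarith
qed auto

lemma symbol_in_symbols:
  assumes "a11 > 0" "a12 > 0" "b12 > 0" "a21 > 0" "b21 > 0" "a22 > 0"
  shows "restrict (symbol a11 a12 b12 a21 b21 a22) (-{0}) \<in> symbols"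
  using assms unfolding symbols_def symbol_def by blast

lemma Q_minus_mult_Q_plus:
  "Q_minus a b \<zeta>1 z ** Q_plus c d \<zeta>2 z =
    symbol (a * (b + c)) (a * c * d) (a * b * d / \<zeta>2) c (b * \<zeta>1) (d * (b * \<zeta>1 / \<zeta>2 + c)) z"
  if "z \<noteq> 0"
  using that
  by (simp add: Q_minus_def Q_plus_def symbol_def mat2_mult mat2_eq_iff algebra_simps)

lemma switched_product:
  assumes "a > 0" "b > 0" "z \<noteq> 0"
  shows "(matrix_inv (mat2 1 0 0 (of_real (a * b))) ** Q_plus c d \<zeta>2 z) **
      (Q_minus a b \<zeta>1 z ** mat2 1 0 0 (of_real (a * b))) =
    symbol (b * (a + d * \<zeta>1 / \<zeta>2)) (a\<^sup>2 * b) (a * b * d / \<zeta>2)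
      c (c * d * \<zeta>1 / a) (c * (a + d)) z"
proof -
  have "of_real (a * b) \<noteq> (0 :: complex)"
    using assms by simp
  then show ?thesis
    using assms
    by (simp add: matrix_inv_mat2_diag Q_minus_def Q_plus_def symbol_def mat2_mult mat2_eq_iff
        field_simps power2_eq_square)
qed

lemma param_map_eq_symbol:
  assumes "u \<noteq> 0" "x \<noteq> 0"
  shows "param_map z1 z2 c1 c2 (u, (x, y)) =
    restrict (symbol (c1 * (1 - y / x)) (- u * x) u (c2 / u) (- c2 * z1 * z2 / (u * x))
      (c1 * (1 + y / x))) (-{0})"
  using assms
  by (auto simp: param_map_def symbol_def mat2_eq_iff restrict_def fun_eq_iff field_simps)

section \<open>The chord through the distinguished point\<close>

text \<open>
  The parameter \<open>n\<close> is positive because the right hand side of the equation of the curve is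
  negative for \<open>x < 0\<close>, which forces \<open>y^2 < x^2\<close>; the last conclusion is that equation divided
  by \<open>z2 - x\<close>.
\<close>

lemma chord_properties:
  fixes c1 c2 z1 z2 x y :: real
  assumes "c2 > 0" "z1 > 0" "z2 > 0" and curve: "(x, y) \<in> ell_curve_minus z1 z2 c1 c2"
  defines "n \<equiv> (x - y) / (x - z2)"
  shows "x < 0" and "\<bar>y\<bar> < - x" and "n > 0" and "y = x - n * (x - z2)"
    and "c1\<^sup>2 * n * (x + y) = - c2 * x * (x - z1)"
proof -
  show "x < 0"
    using curve by (simp add: ell_curve_minus_def)
  have eq: "c1\<^sup>2 * (y\<^sup>2 - x\<^sup>2) = c2 * x * (x - z1) * (x - z2)"
    using curve by (simp add: ell_curve_minus_def ell_curve_def)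
  have "(x - z1) * (x - z2) > 0"
    using \<open>x < 0\<close> assms by (intro mult_neg_neg) auto
  then have "(c2 * x) * ((x - z1) * (x - z2)) < 0"
    using \<open>x < 0\<close> \<open>c2 > 0\<close> by (intro mult_neg_pos[OF mult_pos_neg])
  then have "c1\<^sup>2 * (y\<^sup>2 - x\<^sup>2) < 0"
    using eq by (simp add: mult.assoc)
  then have "y\<^sup>2 < x\<^sup>2"
    by (auto simp: mult_less_0_iff)
  then have "\<bar>y\<bar> < \<bar>x\<bar>"
    using abs_le_square_iff[of x y] by linarith
  then show "\<bar>y\<bar> < - x"
    using \<open>x < 0\<close> by simp
  then show "n > 0"
    using \<open>x < 0\<close> \<open>z2 > 0\<close> unfolding n_def by (intro divide_neg_neg) auto
  have "x - z2 \<noteq> 0"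
    using \<open>x < 0\<close> \<open>z2 > 0\<close> by simp
  then show y: "y = x - n * (x - z2)"
    by (simp add: n_def)
  have "(c1\<^sup>2 * n * (x + y)) * (x - z2) = c1\<^sup>2 * ((n * (x - z2)) * (x + y))"
    by (simp add: algebra_simps)
  also have "n * (x - z2) = x - y"
    using y by simp
  also have "c1\<^sup>2 * ((x - y) * (x + y)) = - (c1\<^sup>2 * (y\<^sup>2 - x\<^sup>2))"
    by (simp add: algebra_simps power2_eq_square)
  also have "\<dots> = (- c2 * x * (x - z1)) * (x - z2)"
    using eq by simp
  finally show "c1\<^sup>2 * n * (x + y) = - c2 * x * (x - z1)"
    by (rule mult_right_cancel[OF \<open>x - z2 \<noteq> 0\<close>, THEN iffD1])
qed

text \<open>
  Below, \<open>X\<close> is the abscissa given by Vieta and \<open>t\<close> its parameter on the line. Both sides have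
  the factors \<open>z2 - x\<close> and \<open>1 - s\<close>, where \<open>s\<close> is the variable; what remains are quadratic
  polynomials with equal leading coefficients. The chord relation makes the constant coefficient
  vanish, and together with the value of \<open>X\<close> it matches the linear ones.
\<close>

lemma line_restriction_factored:
  fixes c1 c2 z1 z2 x y n :: real
  assumes "c2 \<noteq> 0" "x \<noteq> 0" "x \<noteq> z2"
    and y: "y = x - n * (x - z2)"
    and chord: "c1\<^sup>2 * n * (x + y) = - c2 * x * (x - z1)"
  defines "X \<equiv> c1\<^sup>2 * z2 * n\<^sup>2 / (c2 * x)"
  defines "t \<equiv> (X - x) / (z2 - x)"
  shows "line_restriction z1 z2 c1 c2 (x, y) (z2, z2) =
    smult (- c2 * (z2 - x) ^ 3) ([:0, 1:] * [:-1, 1:] * [:-t, 1:])"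
proof -
  define h where "h = z2 - x"
  have z2: "z2 = x + h"
    by (simp add: h_def)
  have "h \<noteq> 0"
    using assms by (simp add: h_def)
  have y': "y = x + n * h"
    by (simp add: y h_def algebra_simps)
  have th: "h * t = X - x"
    using \<open>h \<noteq> 0\<close> by (simp add: t_def h_def)
  have X: "c2 * x * X = c1\<^sup>2 * (x + h) * n\<^sup>2"
    using assms by (simp add: X_def h_def)
  have const: "c1\<^sup>2 * n * (2 * x + n * h) + c2 * x * (x - z1) = 0"
    using chord by (simp add: y' algebra_simps)
  have lin: "c1\<^sup>2 * n * (2 - n) + c2 * (2 * x - z1) = - c2 * (X - x)"
  proof -
    have "x * (c1\<^sup>2 * n * (2 - n) + c2 * (2 * x - z1) + c2 * (X - x)) = 0"
      using X const by algebra
    then show ?thesis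
      using \<open>x \<noteq> 0\<close> by simp
  qed
  have "poly (line_restriction z1 z2 c1 c2 (x, y) (z2, z2)) s =
    poly (smult (- c2 * (z2 - x) ^ 3) ([:0, 1:] * [:-1, 1:] * [:-t, 1:])) s" for s
  proof -
    define L where "L = x + s * h"
    have "poly (line_restriction z1 z2 c1 c2 (x, y) (z2, z2)) s =
      c1\<^sup>2 * ((L + n * h * (1 - s))\<^sup>2 - L\<^sup>2) - c2 * (L * (L - z1) * (L - (x + h)))"
      by (simp add: line_restriction_def Let_def L_def z2 y' poly_power algebra_simps)
    also have "\<dots> = h * (1 - s) * (c1\<^sup>2 * n * (2 * L + n * h * (1 - s)) + c2 * L * (L - z1))"
      by (simp add: L_def power2_eq_square algebra_simps)
    also have "c1\<^sup>2 * n * (2 * L + n * h * (1 - s)) + c2 * L * (L - z1) =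
      (c1\<^sup>2 * n * (2 * x + n * h) + c2 * x * (x - z1)) +
      s * h * (c1\<^sup>2 * n * (2 - n) + c2 * (2 * x - z1)) + c2 * h\<^sup>2 * s\<^sup>2"
      by (simp add: L_def power2_eq_square algebra_simps)
    also have "\<dots> = c2 * h * s * (h * s - (X - x))"
      by (simp only: const lin) (simp add: power2_eq_square algebra_simps)
    also have "\<dots> = c2 * h\<^sup>2 * s * (s - t)"
      by (simp add: power2_eq_square algebra_simps flip: th)
    finally show ?thesis
      by (simp add: power2_eq_square power3_eq_cube algebra_simps flip: h_def)
  qed
  then show ?thesis
    by (simp add: poly_eq_poly_eq_iff[symmetric] fun_eq_iff)
qed

lemma proots_cubic:
  fixes K t :: real
  assumes "K \<noteq> 0"
  shows "proots (smult K ([:0, 1:] * [:-1, 1:] * [:-t, 1:])) = {#0, 1, t#}"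
proof -
  have lin: "proots [:-r, 1:] = {#r#}" for r :: real
    by (simp add: proots_linear_factor)
  show ?thesis
    using assms lin[of 0] lin[of 1] lin[of t]
    by (simp add: proots_mult del: mult_pCons_left mult_pCons_right)
qed

lemma ell_shift_eq:
  fixes c1 c2 z1 z2 x y n :: real
  assumes "c2 \<noteq> 0" "x \<noteq> 0" "x \<noteq> z2"
    and y: "y = x - n * (x - z2)"
    and chord: "c1\<^sup>2 * n * (x + y) = - c2 * x * (x - z1)"
  defines "X \<equiv> c1\<^sup>2 * z2 * n\<^sup>2 / (c2 * x)"
  shows "ell_shift z1 z2 c1 c2 (x, y) = (X, - (X + n * (z2 - X)))"
proof -
  define t where "t = (X - x) / (z2 - x)"
  have "proots (line_restriction z1 z2 c1 c2 (x, y) (z2, z2)) = {#0, 1, t#}"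
    unfolding line_restriction_factored[OF assms(1-5)] t_def X_def
    using assms by (intro proots_cubic) simp
  then have "third_intersection z1 z2 c1 c2 (x, y) (z2, z2) r \<longleftrightarrow>
      r = (x, y) + t *\<^sub>R ((z2, z2) - (x, y))" for r
    using \<open>x \<noteq> z2\<close> by (auto simp: third_intersection_def)
  then have the: "(THE r. third_intersection z1 z2 c1 c2 (x, y) (z2, z2) r) =
      (x, y) + t *\<^sub>R ((z2, z2) - (x, y))"
    by simp
  have t: "t * (z2 - x) = X - x"
    using \<open>x \<noteq> z2\<close> by (simp add: t_def)
  have "y + t * (z2 - y) = y + (1 - n) * (t * (z2 - x))"
    by (simp add: y algebra_simps)
  also have "\<dots> = X + n * (z2 - X)"
    unfolding t by (simp add: y algebra_simps)
  finally show ?thesis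
    using t by (simp add: ell_shift_def the)
qed

section \<open>The factorization of the parametrised matrix\<close>

text \<open>
  By Vieta \<open>\<zeta>1\<close> is a root of \<open>(s - z1) (s - z2)\<close>, and the separating number \<open>m\<close>
  rules out \<open>\<zeta>1 = z2\<close>.
\<close>

lemma separated_roots_unique:
  fixes \<zeta>1 \<zeta>2 z1 z2 :: real
  assumes "\<zeta>1 + \<zeta>2 = z1 + z2" "\<zeta>1 * \<zeta>2 = z1 * z2" "\<zeta>1 < m" "m < \<zeta>2" "z1 < m" "m < z2"
  shows "\<zeta>1 = z1 \<and> \<zeta>2 = z2"
proof -
  have "(\<zeta>1 - z1) * (\<zeta>1 - z2) = 0"
    using assms(1,2) by algebra
  then show ?thesis
    using assms by auto
qed

lemma factor_data_iff_coefficients: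
  assumes "\<And>z. z \<noteq> 0 \<Longrightarrow> P z = symbol a11 a12 b12 a21 b21 a22 z"
  shows "factor_data P (a, b, c, d, \<zeta>1, \<zeta>2) \<longleftrightarrow>
    a > 0 \<and> b > 0 \<and> c > 0 \<and> d > 0 \<and> 0 < \<zeta>1 \<and> \<zeta>1 < 1 \<and> 1 < \<zeta>2 \<and>
    a11 = a * (b + c) \<and> a12 = a * c * d \<and> b12 = a * b * d / \<zeta>2 \<and> a21 = c \<and> b21 = b * \<zeta>1 \<and>
    a22 = d * (b * \<zeta>1 / \<zeta>2 + c)"
  using assms
  by (simp add: factor_data_def Q_minus_mult_Q_plus symbol_eq_iff[symmetric] cong: imp_cong)

text \<open>
  The off-diagonal coefficients give \<open>c = c2 / u\<close>, \<open>a * b * c * d = c2 * \<zeta>2\<close> and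
  \<open>\<zeta>1 * \<zeta>2 = z1 * z2\<close>. The product of the diagonal entries then gives \<open>\<zeta>1 + \<zeta>2 = z1 + z2\<close>,
  because the chord relation turns the product of the diagonal entries of the parametrised matrix
  into \<open>-c2 (x - z1) (x - z2) / x\<close>.
\<close>

lemma factor_data_param_map_iff:
  fixes c1 c2 z1 z2 u x y n :: real
  assumes pos: "c1 > 0" "c2 > 0" "0 < z1" "z1 < 1" "1 < z2" "u > 0" "x < 0" "n > 0"
    and y: "y = x - n * (x - z2)"
    and chord: "c1\<^sup>2 * n * (x + y) = - c2 * x * (x - z1)"
  shows "factor_data (param_map z1 z2 c1 c2 (u, (x, y))) (a, b, c, d, \<zeta>1, \<zeta>2) \<longleftrightarrow>
    (a, b, c, d, \<zeta>1, \<zeta>2) =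
      (c1 * u * n / c2, - c2 * z2 / (u * x), c2 / u, - u * x / (c1 * n), z1, z2)"
proof -
  have diag1: "c1 * (1 - y / x) = c1 * n * (x - z2) / x"
    using pos by (simp add: y field_simps)
  have "c1 * (x + y) * (c1 * n) = - c2 * x * (x - z1)"
    using chord by (simp add: power2_eq_square mult.commute mult.left_commute)
  then have "c1 * (x + y) = - c2 * x * (x - z1) / (c1 * n)"
    using pos by (intro eq_divide_imp) auto
  moreover have "c1 * (1 + y / x) = c1 * (x + y) / x"
    using pos by (simp add: field_simps)
  ultimately have diag2: "c1 * (1 + y / x) = - c2 * (x - z1) / (c1 * n)"
    using pos by (simp add: field_simps)
  have coeffs: "factor_data (param_map z1 z2 c1 c2 (u, (x, y))) (a, b, c, d, \<zeta>1, \<zeta>2) \<longleftrightarrow>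
    a > 0 \<and> b > 0 \<and> c > 0 \<and> d > 0 \<and> 0 < \<zeta>1 \<and> \<zeta>1 < 1 \<and> 1 < \<zeta>2 \<and>
    c1 * n * (x - z2) / x = a * (b + c) \<and> - u * x = a * c * d \<and> u = a * b * d / \<zeta>2 \<and>
    c2 / u = c \<and> - c2 * z1 * z2 / (u * x) = b * \<zeta>1 \<and>
    - c2 * (x - z1) / (c1 * n) = d * (b * \<zeta>1 / \<zeta>2 + c)"
    using pos unfolding diag1[symmetric] diag2[symmetric]
    by (intro factor_data_iff_coefficients) (simp add: param_map_eq_symbol)
  show ?thesis
  proof
    assume "factor_data (param_map z1 z2 c1 c2 (u, (x, y))) (a, b, c, d, \<zeta>1, \<zeta>2)"
    then have fpos: "a > 0" "b > 0" "c > 0" "d > 0" "0 < \<zeta>1" "\<zeta>1 < 1" "1 < \<zeta>2"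
      and e11: "c1 * n * (x - z2) / x = a * (b + c)" and e12: "a * c * d = - u * x"
      and f12: "u = a * b * d / \<zeta>2" and e21: "c = c2 / u"
      and f21: "- c2 * z1 * z2 / (u * x) = b * \<zeta>1"
      and e22: "- c2 * (x - z1) / (c1 * n) = d * (b * \<zeta>1 / \<zeta>2 + c)"
      unfolding coeffs by auto
    have uc: "u * c = c2"
      using e21 pos by simp
    have abd: "a * b * d = u * \<zeta>2"
      using f12 fpos by simp
    have b\<zeta>: "u * x * (b * \<zeta>1) = - c2 * z1 * z2"
      using f21[symmetric] pos by simp
    have "c2 * (\<zeta>1 * \<zeta>2) = (a * b * d) * c * \<zeta>1"
      by (simp add: abd uc[symmetric])
    also have "\<dots> = (a * c * d) * (b * \<zeta>1)"
      by simp
    also have "\<dots> = c2 * (z1 * z2)"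
      using b\<zeta> by (simp add: e12)
    finally have prod: "\<zeta>1 * \<zeta>2 = z1 * z2"
      using pos by simp
    have "- c2 * (x - z1) * (x - z2) / x =
        (c1 * n * (x - z2) / x) * (- c2 * (x - z1) / (c1 * n))"
      using pos by (simp add: field_simps)
    also have "\<dots> = a * (b + c) * (d * (b * \<zeta>1 / \<zeta>2 + c))"
      by (simp only: e11 e22)
    also have "\<dots> = (a * b * d) / \<zeta>2 * (b * \<zeta>1) + (a * b * d) * c + (a * b * d) * c * \<zeta>1 / \<zeta>2
        + (a * c * d) * c"
      using fpos by (simp add: field_simps)
    also have "\<dots> = u * (b * \<zeta>1) + (u * c) * (\<zeta>1 + \<zeta>2) - (u * c) * x"
      using fpos unfolding abd e12 by (simp add: field_simps)
    finally have "x * (u * (b * \<zeta>1) + c2 * (\<zeta>1 + \<zeta>2) - c2 * x) = - c2 * (x - z1) * (x - z2)"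
      using pos unfolding uc by (simp add: field_simps)
    then have "x * c2 * ((\<zeta>1 + \<zeta>2) - (z1 + z2)) = 0"
      using b\<zeta> by algebra
    then have "\<zeta>1 + \<zeta>2 = z1 + z2"
      using pos by simp
    with prod have \<zeta>: "\<zeta>1 = z1" "\<zeta>2 = z2"
      using separated_roots_unique fpos pos by blast+
    have "z1 * (u * x * b) = z1 * (- c2 * z2)"
      using b\<zeta> by (simp add: \<zeta> algebra_simps)
    then have "u * x * b = - c2 * z2"
      by (rule mult_left_cancel[THEN iffD1, rotated]) (use pos in simp)
    then have b: "b = - c2 * z2 / (u * x)"
      using pos by (simp add: field_simps)
    have "b + c = c2 * (x - z2) / (u * x)"
      using pos by (simp add: b e21 field_simps)
    then have "c1 * n * ((x - z2) / x) = (a * c2 / u) * ((x - z2) / x)"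
      using e11 by (simp add: field_simps)
    then have "c1 * n = a * c2 / u"
      by (rule mult_right_cancel[THEN iffD1, rotated]) (use pos in simp)
    then have a: "a = c1 * u * n / c2"
      using pos by (auto simp: field_simps)
    have "d = - u * x / (a * c)"
      using e12 fpos by (simp add: field_simps)
    then have "d = - u * x / (c1 * n)"
      using pos by (simp add: a e21)
    with a b e21 \<zeta> show "(a, b, c, d, \<zeta>1, \<zeta>2) =
        (c1 * u * n / c2, - c2 * z2 / (u * x), c2 / u, - u * x / (c1 * n), z1, z2)"
      by simp
  next
    assume "(a, b, c, d, \<zeta>1, \<zeta>2) =
      (c1 * u * n / c2, - c2 * z2 / (u * x), c2 / u, - u * x / (c1 * n), z1, z2)"
    then have vals: "a = c1 * u * n / c2" "b = - c2 * z2 / (u * x)" "c = c2 / u"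
        "d = - u * x / (c1 * n)" "\<zeta>1 = z1" "\<zeta>2 = z2"
      by simp_all
    have "a > 0" "b > 0" "c > 0" "d > 0"
      using pos by (simp_all add: vals divide_less_0_iff mult_less_0_iff zero_less_mult_iff)
    moreover have "c1 * n * (x - z2) / x = a * (b + c)" "- u * x = a * c * d" "u = a * b * d / \<zeta>2"
        "- c2 * z1 * z2 / (u * x) = b * \<zeta>1"
        "- c2 * (x - z1) / (c1 * n) = d * (b * \<zeta>1 / \<zeta>2 + c)"
      unfolding vals using pos by (simp_all add: field_simps)
    ultimately show "factor_data (param_map z1 z2 c1 c2 (u, (x, y))) (a, b, c, d, \<zeta>1, \<zeta>2)"
      unfolding coeffs using pos vals by blast
  qed
qed

lemma param_map_in_symbols_fix:
  fixes c1 c2 z1 z2 u x y :: real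
  assumes pos: "c1 > 0" "c2 > 0" "z1 > 0" "z2 > 0" "u > 0"
    and curve: "(x, y) \<in> ell_curve_minus z1 z2 c1 c2"
  shows "param_map z1 z2 c1 c2 (u, (x, y)) \<in> symbols_fix z1 z2 c1 c2"
proof -
  note xy = chord_properties(1,2)[OF pos(2-4) curve]
  have eq: "c1\<^sup>2 * (y\<^sup>2 - x\<^sup>2) = c2 * x * (x - z1) * (x - z2)"
    using curve by (simp add: ell_curve_minus_def ell_curve_def)
  have "1 - y / x > 0" "1 + y / x > 0"
    using xy by (auto simp: field_simps)
  then have "param_map z1 z2 c1 c2 (u, (x, y)) \<in> symbols"
    using xy pos
    by (subst param_map_eq_symbol)
      (auto intro!: symbol_in_symbols simp: zero_less_mult_iff mult_less_0_iff divide_less_0_iff)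
  moreover have "trace (param_map z1 z2 c1 c2 (u, (x, y)) z) = 2 * of_real c1" if "z \<noteq> 0" for z
    using that by (simp add: param_map_def trace_mat2 algebra_simps)
  moreover have "det (param_map z1 z2 c1 c2 (u, (x, y)) z) =
      - of_real c2 * (z - of_real z1) * (z - of_real z2) / z" if "z \<noteq> 0" for z
  proof -
    have "x\<^sup>2 * ((c1 * (1 - y / x)) * (c1 * (1 + y / x))) = - (c1\<^sup>2 * (y\<^sup>2 - x\<^sup>2))"
      using xy by (simp add: field_simps power2_eq_square)
    also have "\<dots> = x\<^sup>2 * (- c2 * (x - z1) * (x - z2) / x)"
      using xy unfolding eq by (simp add: power2_eq_square)
    finally have diag: "(c1 * (1 - y / x)) * (c1 * (1 + y / x)) = - c2 * (x - z1) * (x - z2) / x"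
      by (rule mult_left_cancel[THEN iffD1, rotated]) (use xy in simp)
    have "det (param_map z1 z2 c1 c2 (u, (x, y)) z) =
        of_real ((c1 * (1 - y / x)) * (c1 * (1 + y / x))) -
        of_real u * (z - of_real x) *
          (of_real (c2 / u) * (1 - of_real (z1 * z2) / (of_real x * z)))"
      using that by (simp add: param_map_def det_mat2)
    also have "\<dots> = - of_real c2 * (z - of_real z1) * (z - of_real z2) / z"
      unfolding diag using that xy pos by (simp add: field_simps)
    finally show ?thesis .
  qed
  ultimately show ?thesis
    by (simp add: symbols_fix_def)
qed

section \<open>Switching the factors is translation on the curve\<close>

theorem theorem4p6:
  fixes c1 c2 z1 z2 u x y :: real
  assumes "c1 > 0" and "c2 > 0"
    and "0 < z1" and "z1 < 1" and "1 < z2"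
    and "c1^2 / c2 \<ge> (sqrt z1 + sqrt z2)^2"
    and "u > 0" and "(x, y) \<in> ell_curve_minus z1 z2 c1 c2"
  shows "param_map z1 z2 c1 c2 (u, ell_shift z1 z2 c1 c2 (x, y)) =
         switch_map z1 z2 c1 c2 (param_map z1 z2 c1 c2 (u, (x, y)))"
proof -
  define n where "n = (x - y) / (x - z2)"
  have "z2 > 0"
    using assms by simp
  note chord = chord_properties[OF \<open>c2 > 0\<close> \<open>0 < z1\<close> \<open>z2 > 0\<close> assms(8), folded n_def]
  define X where "X = c1\<^sup>2 * z2 * n\<^sup>2 / (c2 * x)"
  define Y where "Y = - (X + n * (z2 - X))"
  define a where "a = c1 * u * n / c2"
  define b where "b = - c2 * z2 / (u * x)"
  define c where "c = c2 / u"
  define d where "d = - u * x / (c1 * n)"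
  note pos = assms(1-5,7) chord(1,3)
  have shift: "ell_shift z1 z2 c1 c2 (x, y) = (X, Y)"
    unfolding X_def Y_def using pos chord(4,5) by (intro ell_shift_eq) auto
  have fd: "factor_data (param_map z1 z2 c1 c2 (u, (x, y))) w \<longleftrightarrow> w = (a, b, c, d, z1, z2)" for w
    unfolding a_def b_def c_def d_def
    by (cases w) (simp only: factor_data_param_map_iff[OF pos chord(4,5)])
  then have factors: "factor_data (param_map z1 z2 c1 c2 (u, (x, y))) (a, b, c, d, z1, z2)"
    by simp
  then have fpos: "a > 0" "b > 0" "c > 0" "d > 0"
    by (simp_all add: factor_data_def)
  have the: "(THE w. factor_data (param_map z1 z2 c1 c2 (u, (x, y))) w) = (a, b, c, d, z1, z2)"
    by (simp add: fd)
  have switch: "switch_map z1 z2 c1 c2 (param_map z1 z2 c1 c2 (u, (x, y))) =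
      restrict (symbol (b * (a + d * z1 / z2)) (a\<^sup>2 * b) (a * b * d / z2)
        c (c * d * z1 / a) (c * (a + d))) (-{0})"
    using param_map_in_symbols_fix[OF assms(1-3) \<open>z2 > 0\<close> assms(7,8)] fpos
    by (simp add: switch_map_def the Let_def switched_product restrict_def fun_eq_iff
        del: of_real_mult)
  have "X \<noteq> 0"
    using pos by (simp add: X_def)
  have X: "X = - a * z2 / d"
    using pos by (simp add: X_def a_def d_def field_simps power2_eq_square)
  have u: "a * b * d / z2 = u"
    using pos by (simp add: a_def b_def d_def field_simps)
  have "Y / X = - 1 + n - n * z2 / X"
    using \<open>X \<noteq> 0\<close> by (simp add: Y_def field_simps)
  also have "n * z2 / X = - c * d / c1"
    using pos by (simp add: X_def c_def d_def field_simps power2_eq_square)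
  also have "n = c * a / c1"
    using pos by (simp add: c_def a_def)
  finally have diag2: "c1 * (1 + Y / X) = c * (a + d)"
    using pos by (simp add: field_simps)
  \<comment> \<open>The factors have been exchanged, so the trace is still \<open>2 * c1\<close>.\<close>
  have "param_map z1 z2 c1 c2 (u, (x, y)) z =
      symbol (c1 * (1 - y / x)) (- u * x) u (c2 / u) (- c2 * z1 * z2 / (u * x))
        (c1 * (1 + y / x)) z" if "z \<noteq> 0" for z
    using pos that by (simp add: param_map_eq_symbol)
  from factor_data_iff_coefficients[OF this, THEN iffD1, OF _ factors]
  have "c1 * (1 - y / x) = a * (b + c)" "c1 * (1 + y / x) = d * (b * z1 / z2 + c)"
    by blast+
  then have "b * (a + d * z1 / z2) + c * (a + d) = c1 * (1 - y / x) + c1 * (1 + y / x)"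
    by (simp add: algebra_simps)
  then have "b * (a + d * z1 / z2) = c1 * (1 - Y / X)"
    using diag2 by (simp add: algebra_simps)
  moreover have "a\<^sup>2 * b = - u * X"
    using fpos \<open>z2 > 0\<close> unfolding X u[symmetric] by (simp add: field_simps power2_eq_square)
  moreover have "c * d * z1 / a = - c2 * z1 * z2 / (u * X)"
    using fpos pos unfolding X c_def by (simp add: field_simps)
  moreover have "c = c2 / u"
    by (simp add: c_def)
  ultimately show ?thesis
    using pos \<open>X \<noteq> 0\<close> unfolding shift switch u diag2[symmetric]
    by (simp add: param_map_eq_symbol)
qed

end
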